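(* Let $(X,d)$ be a nonempty complete metric space and let $T:X\to X$ be continuous and asymptotically regular. Let $s,t$ be positive integers and $\alpha,\beta\in[0,\infty)$, and define $\mathbf{m}:X\times X\to[0,\infty)$ by $$\mathbf{m}(x,y)=d(x,y)+\alpha\,\operatorname{diam}\mathcal{O}_s(x)+\beta\,\operatorname{diam}\mathcal{O}_t(y),$$ where $\mathcal{O}_k(x)=\{T^nx:0\leq n\leq k\}$ for $k\in\mathbb{N}$ and $x\in X$. Suppose that: (i) $d(Tx,Ty)<\mathbf{m}(x,y)$ for every $x,y\in X$ with $x\neq y$; (ii) for any $\epsilon>0$ there exist $\delta>0$ and $N\in\mathbb{N}_0$ such that, for all $x,y\in X$, $$\mathbf{m}(T^Nx,T^Ny)<\delta+\epsilon\ \Longrightarrow\ d(T^{N+1}x,T^{N+1}y)\leq\epsilon.$$ Then $T$ has a unique fixed point $z$, and $T^nx\to z$ for every $x\in X$.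
   Context: $\mathbb{N}=\{1,2,\dots\}$ and $\mathbb{N}_0=\mathbb{N}\cup\{0\}$. A self-map $T$ of $X$ is asymptotically regular if $d(T^nx,T^{n+1}x)\to 0$ for each $x\in X$. For $E\subseteq X$, $\operatorname{diam}E$ denotes the diameter of $E$ with respect to $d$. *)

theory Defs
  imports "HOL-Analysis.Analysis"
begin

definition asymptotically_regular :: "('a::metric_space \<Rightarrow> 'a) \<Rightarrow> bool" where
  "asymptotically_regular T \<longleftrightarrow>
     (\<forall>x. (\<lambda>n. dist ((T ^^ n) x) ((T ^^ Suc n) x)) \<longlonglongrightarrow> 0)"

definition orbit_upto :: "('a \<Rightarrow> 'a) \<Rightarrow> nat \<Rightarrow> 'a \<Rightarrow> 'a set" where
  "orbit_upto T k x = {(T ^^ n) x | n. n \<le> k}"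

(* The orbit segments are finite and nonempty, so the library's real-valued diameter
   is their usual diameter. *)
definition m_dist ::
  "('a::metric_space \<Rightarrow> 'a) \<Rightarrow> nat \<Rightarrow> nat \<Rightarrow> real \<Rightarrow> real \<Rightarrow> 'a \<Rightarrow> 'a \<Rightarrow> real" where
  "m_dist T s t \<alpha> \<beta> x y =
     dist x y + \<alpha> * diameter (orbit_upto T s x) + \<beta> * diameter (orbit_upto T t y)"

end

theory Submission
  imports Defs
begin

text \<open>
  Asymptotic regularity makes the diameters of the orbit segments along an orbit \<open>x\<^sub>n\<close> tend
  to \<open>0\<close>, so that condition (ii) eventually reads: \<open>d(x\<^sub>n, x\<^sub>m) < \<epsilon> + \<delta>/2\<close> implies
  \<open>d(x\<^sub>n\<^sub>+\<^sub>1, x\<^sub>m\<^sub>+\<^sub>1) \<le> \<epsilon>\<close>. As the steps \<open>d(x\<^sub>n, x\<^sub>n\<^sub>+\<^sub>1)\<close> are eventually below \<open>\<delta>/2\<close>, the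
  triangle inequality through \<open>x\<^sub>n\<^sub>+\<^sub>1\<close> propagates \<open>d(x\<^sub>n, x\<^sub>n\<^sub>+\<^sub>k) < \<epsilon> + \<delta>/2\<close> from \<open>k\<close> to \<open>k + 1\<close>,
  and the orbit is Cauchy. On fixed points the segments are singletons, so (i) gives uniqueness.
\<close>

lemma dist_funpow_le_sum:
  fixes T :: "'a::metric_space \<Rightarrow> 'a"
  shows "dist x ((T ^^ i) x) \<le> (\<Sum>l<i. dist ((T ^^ l) x) ((T ^^ Suc l) x))"
proof (induction i)
  case (Suc i)
  then show ?case
    using dist_triangle[of x "(T ^^ Suc i) x" "(T ^^ i) x"] by simp
qed simp

text \<open>Each point of the segment is within the sum of the steps from \<open>x\<close>, so two
  of them are within twice that sum. The factor 2 is crude but harmless, since the bound is only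
  used to tend to 0.\<close>

lemma diameter_orbit_upto_le:
  fixes T :: "'a::metric_space \<Rightarrow> 'a"
  shows "diameter (orbit_upto T k x) \<le> 2 * (\<Sum>l<k. dist ((T ^^ l) x) ((T ^^ Suc l) x))"
proof -
  let ?S = "\<Sum>l<k. dist ((T ^^ l) x) ((T ^^ Suc l) x)"
  \<comment> \<open>\<open>diameter\<close> is a supremum only on nonempty sets, so a member is
    needed for \<open>cSUP_least\<close>.\<close>
  have x_mem: "x \<in> orbit_upto T k x"
    unfolding orbit_upto_def by (auto intro!: exI[of _ 0])
  have near: "dist x u \<le> ?S" if u: "u \<in> orbit_upto T k x" for u
  proof -
    obtain i where i: "u = (T ^^ i) x" "i \<le> k"
      using u unfolding orbit_upto_def by blast
    have "(\<Sum>l<i. dist ((T ^^ l) x) ((T ^^ Suc l) x)) \<le> ?S"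
      using i(2) by (intro sum_mono2) auto
    then show ?thesis
      using dist_funpow_le_sum[where x = x and T = T and i = i] i(1) by simp
  qed
  have "dist u v \<le> 2 * ?S" if "u \<in> orbit_upto T k x" "v \<in> orbit_upto T k x" for u v
    using near[OF that(1)] near[OF that(2)] dist_triangle3[of u v x] by linarith
  then show ?thesis
    unfolding diameter_def using x_mem by (auto intro!: cSUP_least)
qed

text \<open>With \<open>k\<close> fixed, the bound on the diameter is a sum of \<open>k\<close>
  shifts of one null sequence, hence null itself.\<close>

lemma eventually_diameter_orbit_upto_less:
  fixes T :: "'a::metric_space \<Rightarrow> 'a"
  assumes "asymptotically_regular T" "c \<ge> 0" "e > 0"
  shows "\<forall>\<^sub>F n in sequentially. c * diameter (orbit_upto T k ((T ^^ n) x)) < e"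
proof -
  let ?d = "\<lambda>n. dist ((T ^^ n) x) ((T ^^ Suc n) x)"
  have "?d \<longlonglongrightarrow> 0"
    using assms(1) unfolding asymptotically_regular_def by blast
  then have "(\<lambda>n. ?d (n + l)) \<longlonglongrightarrow> 0" for l
    by (rule LIMSEQ_ignore_initial_segment)
  then have "(\<lambda>n. c * (2 * (\<Sum>l<k. ?d (n + l)))) \<longlonglongrightarrow> c * (2 * (\<Sum>l<k. 0))"
    by (intro tendsto_intros)
  then have "\<forall>\<^sub>F n in sequentially. c * (2 * (\<Sum>l<k. ?d (n + l))) < e"
    using assms(3) by (intro order_tendstoD(2)[where y = "c * (2 * (\<Sum>l<k. 0))"]) simp_all
  then show ?thesis
  proof (rule eventually_mono)
    fix n assume less: "c * (2 * (\<Sum>l<k. ?d (n + l))) < e"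
    have "(T ^^ l) ((T ^^ n) x) = (T ^^ (n + l)) x" for l
      by (metis add.commute comp_apply funpow_add)
    then have "diameter (orbit_upto T k ((T ^^ n) x)) \<le> 2 * (\<Sum>l<k. ?d (n + l))"
      using diameter_orbit_upto_le[of T k "(T ^^ n) x"] by simp
    then show "c * diameter (orbit_upto T k ((T ^^ n) x)) < e"
      using less mult_left_mono[OF _ assms(2)] by (meson le_less_trans)
  qed
qed

lemma orbit_upto_fixed_point: "T z = z \<Longrightarrow> orbit_upto T k z = {z}"
proof -
  assume "T z = z"
  then have "(T ^^ n) z = z" for n by (induction n) auto
  then show ?thesis unfolding orbit_upto_def by auto
qed

lemma Cauchy_orbit:
  fixes T :: "'a::metric_space \<Rightarrow> 'a"
  assumes reg: "asymptotically_regular T"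
    and nonneg: "\<alpha> \<ge> 0" "\<beta> \<ge> 0"
    and contr: "\<And>\<epsilon>::real. \<epsilon> > 0 \<Longrightarrow> \<exists>\<delta>>0. \<exists>N::nat. \<forall>x y.
           m_dist T s t \<alpha> \<beta> ((T ^^ N) x) ((T ^^ N) y) < \<delta> + \<epsilon>
           \<longrightarrow> dist ((T ^^ (N + 1)) x) ((T ^^ (N + 1)) y) \<le> \<epsilon>"
  shows "Cauchy (\<lambda>n. (T ^^ n) x)"
proof (rule metric_CauchyI)
  fix e :: real assume "e > 0"
  \<comment> \<open>Two orbit points will be compared through a third, at a cost below 2 (\<epsilon>
    + \<delta>/2) \<le> 3 \<epsilon> < e; the cap \<delta> \<le> \<epsilon> below serves this
    estimate.\<close>
  define \<epsilon> where "\<epsilon> = e / 4"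
  have \<epsilon>: "\<epsilon> > 0" using \<open>e > 0\<close> unfolding \<epsilon>_def by simp
  obtain \<delta>' N where \<delta>': "\<delta>' > 0" and N: "\<And>x y.
      m_dist T s t \<alpha> \<beta> ((T ^^ N) x) ((T ^^ N) y) < \<delta>' + \<epsilon>
      \<Longrightarrow> dist ((T ^^ (N + 1)) x) ((T ^^ (N + 1)) y) \<le> \<epsilon>"
    using contr[OF \<epsilon>] by blast
  define \<delta> where "\<delta> = min \<delta>' \<epsilon>"
  have \<delta>: "\<delta> > 0" "\<delta> \<le> \<delta>'" "\<delta> \<le> \<epsilon>" using \<delta>' \<epsilon> unfolding \<delta>_def by auto
  have "(\<lambda>n. dist ((T ^^ n) x) ((T ^^ Suc n) x)) \<longlonglongrightarrow> 0"
    using reg unfolding asymptotically_regular_def by blast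
  then have "\<forall>\<^sub>F n in sequentially. dist ((T ^^ n) x) ((T ^^ Suc n) x) < \<delta> / 2"
    using \<delta>(1) by (intro order_tendstoD(2)) auto
  moreover have "\<forall>\<^sub>F n in sequentially. \<alpha> * diameter (orbit_upto T s ((T ^^ n) x)) < \<delta> / 4"
    "\<forall>\<^sub>F n in sequentially. \<beta> * diameter (orbit_upto T t ((T ^^ n) x)) < \<delta> / 4"
    using \<delta>(1) nonneg by (intro eventually_diameter_orbit_upto_less[OF reg]; simp)+
  \<comment> \<open>The slack \<delta> is split as \<delta>/2 for the distance and \<delta>/4 for
    each diameter term, which keeps \<open>m_dist\<close> below \<epsilon> + \<delta>.\<close>
  ultimately have "\<forall>\<^sub>F n in sequentially. n \<ge> N \<and> dist ((T ^^ n) x) ((T ^^ Suc n) x) < \<delta> / 2 \<and>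
      \<alpha> * diameter (orbit_upto T s ((T ^^ n) x)) < \<delta> / 4 \<and>
      \<beta> * diameter (orbit_upto T t ((T ^^ n) x)) < \<delta> / 4"
    using eventually_ge_at_top[of N] by eventually_elim auto
  then obtain M where M: "\<And>n. n \<ge> M \<Longrightarrow> n \<ge> N"
      "\<And>n. n \<ge> M \<Longrightarrow> dist ((T ^^ n) x) ((T ^^ Suc n) x) < \<delta> / 2"
      "\<And>n. n \<ge> M \<Longrightarrow> \<alpha> * diameter (orbit_upto T s ((T ^^ n) x)) < \<delta> / 4"
      "\<And>n. n \<ge> M \<Longrightarrow> \<beta> * diameter (orbit_upto T t ((T ^^ n) x)) < \<delta> / 4"
    unfolding eventually_sequentially by blast
  have step: "dist ((T ^^ Suc n) x) ((T ^^ Suc m) x) \<le> \<epsilon>"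
    if "n \<ge> M" "m \<ge> M" and close: "dist ((T ^^ n) x) ((T ^^ m) x) < \<epsilon> + \<delta> / 2" for n m
  proof -
    \<comment> \<open>Condition (ii) concerns only points in the range of \<open>T ^^ N\<close>;
      orbit points of index at least \<open>N\<close> are such points.\<close>
    have split: "(T ^^ N) ((T ^^ (p - N)) x) = (T ^^ p) x"
      "(T ^^ (N + 1)) ((T ^^ (p - N)) x) = (T ^^ Suc p) x" if "p \<ge> M" for p
    proof -
      show *: "(T ^^ N) ((T ^^ (p - N)) x) = (T ^^ p) x"
        using M(1)[OF that] by (metis comp_apply funpow_add le_add_diff_inverse)
      show "(T ^^ (N + 1)) ((T ^^ (p - N)) x) = (T ^^ Suc p) x"
        using * by simp
    qed
    have "m_dist T s t \<alpha> \<beta> ((T ^^ n) x) ((T ^^ m) x) < \<delta>' + \<epsilon>"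
      unfolding m_dist_def using close M(3)[OF that(1)] M(4)[OF that(2)] \<delta>(2) by linarith
    then show ?thesis
      using N[of "(T ^^ (n - N)) x" "(T ^^ (m - N)) x"] split[OF that(1)] split[OF that(2)]
      by simp
  qed
  have close: "dist ((T ^^ M) x) ((T ^^ (M + k)) x) < \<epsilon> + \<delta> / 2" for k
  proof (induction k)
    case 0
    then show ?case using \<epsilon> \<delta>(1) by simp
  next
    case (Suc k)
    \<comment> \<open>Applying \<open>step\<close> brings the bound back to \<epsilon>, which leaves
      exactly \<delta>/2 for the single step from index \<open>M\<close> to
      \<open>Suc M\<close>.\<close>
    have "dist ((T ^^ Suc M) x) ((T ^^ Suc (M + k)) x) \<le> \<epsilon>"
      using step[OF _ _ Suc] by simp
    then show ?case
      using M(2)[of M]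
        dist_triangle[of "(T ^^ M) x" "(T ^^ Suc (M + k)) x" "(T ^^ Suc M) x"] by simp
  qed
  have "dist ((T ^^ m) x) ((T ^^ n) x) < e" if "m \<ge> M" "n \<ge> M" for m n
  proof -
    have "dist ((T ^^ M) x) ((T ^^ m) x) < \<epsilon> + \<delta> / 2" "dist ((T ^^ M) x) ((T ^^ n) x) < \<epsilon> + \<delta> / 2"
      using close[of "m - M"] close[of "n - M"] that by simp_all
    then show ?thesis
      using dist_triangle3[of "(T ^^ m) x" "(T ^^ n) x" "(T ^^ M) x"] \<delta>(3) \<epsilon>
      unfolding \<epsilon>_def by linarith
  qed
  then show "\<exists>M. \<forall>m\<ge>M. \<forall>n\<ge>M. dist ((T ^^ m) x) ((T ^^ n) x) < e" by blast
qed

lemma orbit_limit_fixed_point: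
  fixes T :: "'a::t2_space \<Rightarrow> 'a"
  assumes "continuous_on UNIV T" and lim: "(\<lambda>n. (T ^^ n) x) \<longlonglongrightarrow> z"
  shows "T z = z"
proof -
  have "isCont T z"
    using assms(1) by (simp add: continuous_on_eq_continuous_at)
  then have "(\<lambda>n. T ((T ^^ n) x)) \<longlonglongrightarrow> T z"
    using lim by (rule isCont_tendsto_compose)
  moreover have "(\<lambda>n. T ((T ^^ n) x)) \<longlonglongrightarrow> z"
    using LIMSEQ_Suc[OF lim] by simp
  ultimately show ?thesis by (rule LIMSEQ_unique)
qed

theorem theorem3p8:
  fixes T :: "'a::complete_space \<Rightarrow> 'a"
    and s t :: nat and \<alpha> \<beta> :: real
  assumes "continuous_on UNIV T"
    and "asymptotically_regular T"
    and "s > 0" and "t > 0"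
    and "\<alpha> \<ge> 0" and "\<beta> \<ge> 0"
    and "\<And>x y. x \<noteq> y \<Longrightarrow> dist (T x) (T y) < m_dist T s t \<alpha> \<beta> x y"
    and "\<And>\<epsilon>::real. \<epsilon> > 0 \<Longrightarrow> \<exists>\<delta>>0. \<exists>N::nat. \<forall>x y.
           m_dist T s t \<alpha> \<beta> ((T ^^ N) x) ((T ^^ N) y) < \<delta> + \<epsilon>
           \<longrightarrow> dist ((T ^^ (N + 1)) x) ((T ^^ (N + 1)) y) \<le> \<epsilon>"
  shows "\<exists>z. T z = z \<and> (\<forall>w. T w = w \<longrightarrow> w = z) \<and> (\<forall>x. (\<lambda>n. (T ^^ n) x) \<longlonglongrightarrow> z)"
proof -
  have conv: "\<exists>z. T z = z \<and> (\<lambda>n. (T ^^ n) x) \<longlonglongrightarrow> z" for x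
    using Cauchy_convergent[OF Cauchy_orbit[OF assms(2,5,6,8)]]
      orbit_limit_fixed_point[OF assms(1)]
    unfolding convergent_def by blast
  have unique: "w = z" if "T w = w" "T z = z" for w z
    using assms(7)[of w z] that by (auto simp: m_dist_def orbit_upto_fixed_point)
  show ?thesis
    \<comment> \<open>The limit in \<open>conv\<close> may a priori depend on \<open>x\<close>;
      being a fixed point, it is the same for all \<open>x\<close> by \<open>unique\<close>.\<close>
    using conv unique by metis
qed

end
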